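(* Let $H$ be an oriented graph with maximum degree $\Delta(H)\le 4$ and directed girth at least $3$ (i.e., every oriented graph of maximum degree at most $4$). Then the arc set $A(H)$ can be partitioned into $3$ feedback arc sets of $H$.
   Context: An oriented graph (orgraph) is a digraph with no loops, no multiple arcs and no directed $2$-cycles. The degree of a vertex is the sum of its in-degree and out-degree; $\Delta(H)$ is the maximum degree. The directed girth is the minimum length of a directed cycle ($\infty$ if there is none). A set $F\subseteq A(H)$ is a feedback arc set if $H-F$ has no directed cycle. *)

theory Defs
  imports "Graph_Theory.Graph_Theory" "HOL-Library.Extended_Nat"
begin

locale oriented_graph = digraph +
  assumes no_2cycles: "cycle p \<Longrightarrow> length p \<noteq> 2"

definition vertex_degree :: "('a, 'b) pre_digraph \<Rightarrow> 'a \<Rightarrow> nat" where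
  "vertex_degree H v = in_degree H v + out_degree H v"

text \<open>The inserted \<open>0\<close> only matters for the null graph, which has maximum degree \<open>0\<close>.\<close>
definition max_degree :: "('a, 'b) pre_digraph \<Rightarrow> nat" where
  "max_degree H = Max (insert 0 (vertex_degree H ` verts H))"

text \<open>The infimum of the empty set in \<^typ>\<open>enat\<close> is \<open>\<infinity>\<close>, the value for acyclic digraphs.\<close>
definition directed_girth :: "('a, 'b) pre_digraph \<Rightarrow> enat" where
  "directed_girth H = (INF p \<in> {p. pre_digraph.cycle H p}. enat (length p))"

definition del_arcs :: "('a, 'b) pre_digraph \<Rightarrow> 'b set \<Rightarrow> ('a, 'b) pre_digraph" where
  "del_arcs H F = H\<lparr>arcs := arcs H - F\<rparr>"

definition feedback_arc_set :: "('a, 'b) pre_digraph \<Rightarrow> 'b set \<Rightarrow> bool" where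
  "feedback_arc_set H F \<longleftrightarrow> F \<subseteq> arcs H \<and> \<not> (\<exists>p. pre_digraph.cycle (del_arcs H F) p)"

text \<open>Every oriented graph has directed girth at least \<open>3\<close>, so that hypothesis is redundant.\<close>
lemma (in oriented_graph) directed_girth_ge_3: "3 \<le> directed_girth G"
  unfolding directed_girth_def
proof (rule INF_greatest)
  fix p assume "p \<in> {p. cycle p}"
  then have p: "cycle p" by simp
  then have "2 \<le> length p" using cycle_digraph_conv by blast
  with no_2cycles[OF p] have "3 \<le> length p" by linarith
  then show "3 \<le> enat (length p)" by (simp add: numeral_eq_enat)
qed

lemma (in fin_digraph) max_degree_le_iff:
  "max_degree G \<le> k \<longleftrightarrow> (\<forall>v \<in> verts G. in_degree G v + out_degree G v \<le> k)"
  by (simp add: max_degree_def vertex_degree_def)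

end

theory Submission
  imports Defs
begin

text \<open>
  It suffices to find a feedback arc set \<open>F\<close> of the arc relation \<open>R\<close> and two rankings of the
  vertices such that arcs of \<open>F\<close> increase in both and every other arc increases in at least one:
  the arcs outside \<open>F\<close> are then split according to whether the first ranking increases.

  Take \<open>F\<close> of minimum size and, among those, with the most vertices having two incoming or two
  outgoing \<open>F\<close>-arcs. Replacing the \<open>F\<close>-arcs at a vertex by all its incoming (or all its outgoing)
  arcs again gives a feedback arc set. By minimality every vertex has \<open>F\<close>-degree at most \<open>2\<close>, and an
  arc outside \<open>F\<close> never joins two vertices of \<open>F\<close>-degree \<open>2\<close>; by the second choice, a vertex with
  one incoming and one outgoing \<open>F\<close>-arc lies between a vertex with two outgoing and a vertex with
  two incoming \<open>F\<close>-arcs. So the components of \<open>F\<close> are paths and cycles, and arcs outside \<open>F\<close> within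
  a component are incident with one of the at most two ends of a path. The two rankings list the
  components in opposite orders; inside a component the first one puts one end as early and the
  other end as late as \<open>F\<close> permits, and the second one exchanges the roles of the ends.
\<close>

section \<open>Feedback arc sets of a relation, extremal choices and reversal of arcs\<close>

definition deg :: "'a rel \<Rightarrow> 'a \<Rightarrow> nat" where
  "deg F v = card (F\<inverse> `` {v}) + card (F `` {v})"

definition fas :: "'a rel \<Rightarrow> 'a rel \<Rightarrow> bool" where
  "fas R F \<longleftrightarrow> F \<subseteq> R \<and> acyclic (R - F)"

definition min_fas :: "'a rel \<Rightarrow> 'a rel \<Rightarrow> bool" where
  "min_fas R F \<longleftrightarrow> fas R F \<and> (\<forall>F'. fas R F' \<longrightarrow> card F \<le> card F')"

text \<open>Only the replacement by incoming arcs is encoded; its consequences for outgoing arcs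
  follow by passing to converse relations.\<close>

definition switch_in :: "'a rel \<Rightarrow> 'a rel \<Rightarrow> 'a \<Rightarrow> 'a rel" where
  "switch_in R F v = {(a, b) \<in> F. a \<noteq> v \<and> b \<noteq> v} \<union> {(a, b) \<in> R. b = v}"

definition heavy :: "'a rel \<Rightarrow> 'a set" where
  "heavy F = {v. card (F\<inverse> `` {v}) = 2 \<or> card (F `` {v}) = 2}"

definition best_fas :: "'a rel \<Rightarrow> 'a rel \<Rightarrow> bool" where
  "best_fas R F \<longleftrightarrow> min_fas R F \<and> (\<forall>F'. min_fas R F' \<longrightarrow> card (heavy F') \<le> card (heavy F))"

text \<open>The asymmetry clause with \<open>u = v\<close> rules out loops as well.\<close>

definition orgraph4 :: "'a rel \<Rightarrow> bool" where
  "orgraph4 R \<longleftrightarrow> finite R \<and> (\<forall>u v. (u, v) \<in> R \<longrightarrow> (v, u) \<notin> R) \<and> (\<forall>v. deg R v \<le> 4)"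

lemma deg_converse [simp]: "deg (F\<inverse>) v = deg F v"
  by (simp add: deg_def)

lemma heavy_converse [simp]: "heavy (F\<inverse>) = heavy F"
  by (auto simp: heavy_def)

lemma orgraph4_converse: "orgraph4 R \<Longrightarrow> orgraph4 (R\<inverse>)"
  by (simp add: orgraph4_def)

lemma fas_converse [simp]: "fas (R\<inverse>) (F\<inverse>) \<longleftrightarrow> fas R F"
proof -
  have "R\<inverse> - F\<inverse> = (R - F)\<inverse>" by auto
  then show ?thesis by (auto simp: fas_def acyclic_converse)
qed

lemma min_fas_converse:
  assumes "min_fas R F"
  shows "min_fas (R\<inverse>) (F\<inverse>)"
  unfolding min_fas_def
proof (intro conjI allI impI)
  show "fas (R\<inverse>) (F\<inverse>)" using assms by (simp add: min_fas_def)
  fix F' assume "fas (R\<inverse>) F'"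
  then have "fas R (F'\<inverse>)" using fas_converse[of R "F'\<inverse>"] by simp
  then have "card F \<le> card (F'\<inverse>)" using assms unfolding min_fas_def by blast
  then show "card (F\<inverse>) \<le> card F'" by simp
qed

lemma best_fas_converse:
  assumes "best_fas R F"
  shows "best_fas (R\<inverse>) (F\<inverse>)"
  unfolding best_fas_def
proof (intro conjI allI impI)
  show "min_fas (R\<inverse>) (F\<inverse>)" using assms by (simp add: best_fas_def min_fas_converse)
  fix F' assume "min_fas (R\<inverse>) F'"
  then have "min_fas R (F'\<inverse>)" using min_fas_converse[of "R\<inverse>" F'] by simp
  then have "card (heavy (F'\<inverse>)) \<le> card (heavy F)" using assms unfolding best_fas_def by blast
  then show "card (heavy F') \<le> card (heavy (F\<inverse>))" by simp
qed

lemma finite_heavy: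
  assumes "finite F"
  shows "finite (heavy F)"
proof (rule finite_subset)
  show "heavy F \<subseteq> Field F"
  proof
    fix v assume "v \<in> heavy F"
    then have "F\<inverse> `` {v} \<noteq> {} \<or> F `` {v} \<noteq> {}" by (auto simp: heavy_def)
    then show "v \<in> Field F" by (auto simp: Field_def)
  qed
  show "finite (Field F)" using assms by (rule finite_Field)
qed

lemma fas_subset: "fas R F \<Longrightarrow> F \<subseteq> R"
  by (simp add: fas_def)

lemma min_fas_fas: "min_fas R F \<Longrightarrow> fas R F"
  by (simp add: min_fas_def)

lemma best_fas_min_fas: "best_fas R F \<Longrightarrow> min_fas R F"
  by (simp add: best_fas_def)

section \<open>Switching at a vertex\<close>

text \<open>Once all arcs into \<open>v\<close> are removed, no cycle passes through
  \<open>v\<close>; a cycle avoiding \<open>v\<close> would already use only arcs outside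
  \<open>F\<close>.\<close>

lemma fas_switch_in:
  assumes "fas R F" and irr: "(v, v) \<notin> R"
  shows "fas R (switch_in R F v)"
proof -
  have sub: "switch_in R F v \<subseteq> R"
    using assms by (auto simp: switch_in_def fas_def)
  let ?s = "R - switch_in R F v"
  have nov: "y \<noteq> v" if "(x, y) \<in> ?s\<^sup>+" for x y
    using that by (induction rule: trancl.induct) (auto simp: switch_in_def)
  have tr: "x \<noteq> v \<Longrightarrow> (x, y) \<in> (R - F)\<^sup>+" if "(x, y) \<in> ?s\<^sup>+" for x y
    using that
  proof (induction rule: trancl.induct)
    case (r_into_trancl a b)
    then have "(a, b) \<in> R - F" by (auto simp: switch_in_def)
    then show ?case by blast
  next
    case (trancl_into_trancl a b c)
    have "b \<noteq> v" using nov trancl_into_trancl.hyps(1) by blast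
    then have "(b, c) \<in> R - F" using trancl_into_trancl.hyps(2) by (auto simp: switch_in_def)
    then show ?case using trancl_into_trancl by (meson trancl.trancl_into_trancl)
  qed
  have "(x, x) \<notin> ?s\<^sup>+" for x
    using nov[of x x] tr[of x x] assms(1) by (auto simp: fas_def acyclic_def)
  with sub show ?thesis by (auto simp: fas_def acyclic_def)
qed

text \<open>The switch trades the \<open>deg F v\<close> arcs of \<open>F\<close> at
  \<open>v\<close> for all arcs into \<open>v\<close>; the additive form avoids subtraction of
  naturals. Without a loop at \<open>v\<close>, no arc is counted twice in
  \<open>deg F v\<close>.\<close>

lemma card_switch_in:
  assumes "finite R" "F \<subseteq> R" "(v, v) \<notin> R"
  shows "card (switch_in R F v) + deg F v = card F + card (R\<inverse> `` {v})"
proof -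
  have fF: "finite F" using assms finite_subset by blast
  let ?K = "{(a, b) \<in> F. a \<noteq> v \<and> b \<noteq> v}"
  let ?I = "(\<lambda>a. (a, v)) ` (F\<inverse> `` {v})" and ?O = "(\<lambda>b. (v, b)) ` (F `` {v})"
  have fK: "finite ?K" by (rule finite_subset[OF _ fF]) auto
  have fI: "finite ?I" by (rule finite_subset[OF _ fF]) auto
  have fO: "finite ?O" by (rule finite_subset[OF _ fF]) auto
  have F: "F = ?K \<union> (?I \<union> ?O)" by auto
  have vv: "(v, v) \<notin> F" using assms by auto
  have "card F = card ?K + card (?I \<union> ?O)"
    by (subst F, rule card_Un_disjoint) (use fK fI fO in auto)
  also have "card (?I \<union> ?O) = card ?I + card ?O"
    by (rule card_Un_disjoint) (use fI fO vv in auto)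
  also have "card ?I = card (F\<inverse> `` {v})" by (rule card_image) (auto simp: inj_on_def)
  also have "card ?O = card (F `` {v})" by (rule card_image) (auto simp: inj_on_def)
  finally have 1: "card F = card ?K + deg F v" by (simp add: deg_def)
  let ?J = "(\<lambda>a. (a, v)) ` (R\<inverse> `` {v})"
  have fJ: "finite ?J" by (rule finite_subset[OF _ assms(1)]) auto
  have S: "switch_in R F v = ?K \<union> ?J" by (auto simp: switch_in_def)
  have "card (switch_in R F v) = card ?K + card ?J"
    unfolding S by (rule card_Un_disjoint) (use fK fJ in auto)
  also have "card ?J = card (R\<inverse> `` {v})" by (rule card_image) (auto simp: inj_on_def)
  finally show ?thesis using 1 by simp
qed

lemma orgraph4_irrefl: "orgraph4 R \<Longrightarrow> (v, v) \<notin> R"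
  unfolding orgraph4_def by blast

text \<open>Otherwise switching at \<open>v\<close> would give a smaller feedback arc set.\<close>

lemma deg_le_indegree:
  assumes "orgraph4 R" "min_fas R F"
  shows "deg F v \<le> card (R\<inverse> `` {v})"
proof -
  have "fas R (switch_in R F v)"
    using assms by (intro fas_switch_in min_fas_fas orgraph4_irrefl)
  then have "card F \<le> card (switch_in R F v)" using assms by (simp add: min_fas_def)
  moreover have "card (switch_in R F v) + deg F v = card F + card (R\<inverse> `` {v})"
    using assms by (intro card_switch_in orgraph4_irrefl fas_subset min_fas_fas)
      (auto simp: orgraph4_def)
  ultimately show ?thesis by linarith
qed

lemma deg_le_outdegree:
  assumes "orgraph4 R" "min_fas R F"
  shows "deg F v \<le> card (R `` {v})"
  using deg_le_indegree[OF orgraph4_converse[OF assms(1)] min_fas_converse[OF assms(2)]] by simp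

text \<open>In-degree and out-degree both bound \<open>deg F v\<close> and sum to at most 4.\<close>

lemma deg_min_fas_le_2:
  assumes "orgraph4 R" "min_fas R F"
  shows "deg F v \<le> 2"
proof -
  have "deg R v \<le> 4" using assms by (simp add: orgraph4_def)
  then show ?thesis using deg_le_indegree[OF assms, of v] deg_le_outdegree[OF assms, of v]
    by (simp add: deg_def[of R])
qed

lemma indegree_eq_2:
  assumes "orgraph4 R" "min_fas R F" "deg F v = 2"
  shows "card (R\<inverse> `` {v}) = 2"
proof -
  have "deg R v \<le> 4" using assms by (simp add: orgraph4_def)
  then show ?thesis using deg_le_indegree[OF assms(1,2), of v] deg_le_outdegree[OF assms(1,2), of v]
    by (simp add: deg_def[of R] assms(3))
qed

text \<open>Here \<open>v\<close> has in-degree exactly 2, so the switch trades two arcs for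
  two.\<close>

lemma min_fas_switch_in:
  assumes "orgraph4 R" "min_fas R F" "deg F v = 2"
  shows "min_fas R (switch_in R F v)"
proof -
  have "fas R (switch_in R F v)"
    using assms by (intro fas_switch_in min_fas_fas orgraph4_irrefl)
  moreover have "card (switch_in R F v) + deg F v = card F + card (R\<inverse> `` {v})"
    using assms by (intro card_switch_in orgraph4_irrefl fas_subset min_fas_fas)
      (auto simp: orgraph4_def)
  then have "card (switch_in R F v) = card F" using indegree_eq_2[OF assms] assms(3) by simp
  ultimately show ?thesis using assms(2) by (simp add: min_fas_def)
qed

lemma min_fas_finite: "orgraph4 R \<Longrightarrow> min_fas R F \<Longrightarrow> finite F"
  by (meson fas_subset finite_subset min_fas_fas orgraph4_def)

section \<open>Local structure around vertices of \<open>F\<close>-degree 2\<close>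

text \<open>Switching at \<open>v\<close> keeps the arcs of \<open>F\<close> at \<open>p\<close> and
  adds \<open>(p, v)\<close>, yet the result is still minimum and so has degree at most 2 at
  \<open>p\<close>.\<close>

lemma deg_in_neighbour_le_1:
  assumes R: "orgraph4 R" and F: "min_fas R F" and v: "deg F v = 2"
    and p: "(p, v) \<in> R" "(p, v) \<notin> F"
  shows "deg F p \<le> 1"
proof -
  let ?F = "switch_in R F v"
  have F': "min_fas R ?F" using R F v by (rule min_fas_switch_in)
  have fF: "finite F" using R F by (rule min_fas_finite)
  have FR: "F \<subseteq> R" using F by (intro fas_subset min_fas_fas)
  have vp: "(v, p) \<notin> R" "p \<noteq> v" using R p unfolding orgraph4_def by blast+
  have "?F `` {p} = insert v (F `` {p})" "?F\<inverse> `` {p} = F\<inverse> `` {p}"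
    using p vp FR by (auto simp: switch_in_def)
  then have "deg ?F p = Suc (deg F p)"
    using p fF by (simp add: deg_def finite_Image)
  then show ?thesis using deg_min_fas_le_2[OF R F', of p] by simp
qed

lemma deg_out_neighbour_le_1:
  assumes "orgraph4 R" "min_fas R F" "deg F v = 2" "(v, q) \<in> R" "(v, q) \<notin> F"
  shows "deg F q \<le> 1"
  using deg_in_neighbour_le_1[OF orgraph4_converse[OF assms(1)] min_fas_converse[OF assms(2)], of v q]
    assms(3-5) by simp

text \<open>Otherwise switching at \<open>v\<close> makes \<open>v\<close> heavy and keeps every
  other heavy vertex heavy, against the second extremal choice.\<close>

lemma through_succ:
  assumes R: "orgraph4 R" and F: "best_fas R F"
    and v: "card (F\<inverse> `` {v}) = 1" "card (F `` {v}) = 1" and w: "(v, w) \<in> F"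
  shows "card (F\<inverse> `` {w}) = 2"
proof (rule ccontr)
  assume w2: "card (F\<inverse> `` {w}) \<noteq> 2"
  let ?F = "switch_in R F v"
  have mF: "min_fas R F" using F by (rule best_fas_min_fas)
  have FR: "F \<subseteq> R" using mF by (intro fas_subset min_fas_fas)
  have v2: "deg F v = 2" using v by (simp add: deg_def)
  have F': "min_fas R ?F" using R mF v2 by (rule min_fas_switch_in)
  have only: "u = w" if "(v, u) \<in> F" for u
  proof -
    obtain x where "F `` {v} = {x}" using v(2) by (auto simp: card_1_singleton_iff)
    then show ?thesis using that w by (metis Image_singleton_iff singletonD)
  qed
  have "v \<notin> heavy F" using v by (simp add: heavy_def)
  moreover have "v \<in> heavy ?F"
  proof -
    have "?F\<inverse> `` {v} = R\<inverse> `` {v}" by (auto simp: switch_in_def)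
    then show ?thesis using indegree_eq_2[OF R mF v2] by (simp add: heavy_def)
  qed
  moreover have "u \<in> heavy ?F" if u: "u \<in> heavy F" "u \<noteq> v" for u
    using u(1) unfolding heavy_def mem_Collect_eq
  proof
    assume a: "card (F\<inverse> `` {u}) = 2"
    then have "(v, u) \<notin> F" using only w2 by blast
    then have "?F\<inverse> `` {u} = F\<inverse> `` {u}" using u(2) by (auto simp: switch_in_def)
    then show "card (?F\<inverse> `` {u}) = 2 \<or> card (?F `` {u}) = 2" using a by simp
  next
    \<comment> \<open>A third outgoing arc at \<open>u\<close> would spoil heaviness. It could only
      be \<open>(u, v)\<close>, which the neighbour lemma forces to be in \<open>F\<close> already
      if it is in \<open>R\<close>.\<close>
    assume a: "card (F `` {u}) = 2"
    then have "2 \<le> deg F u" by (simp add: deg_def)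
    then have "(u, v) \<in> F" if "(u, v) \<in> R"
      using deg_in_neighbour_le_1[OF R mF v2 that] by fastforce
    then have "?F `` {u} = F `` {u}" using u(2) FR by (auto simp: switch_in_def)
    then show "card (?F\<inverse> `` {u}) = 2 \<or> card (?F `` {u}) = 2" using a by simp
  qed
  ultimately have "heavy F \<subset> heavy ?F" by blast
  then have "card (heavy F) < card (heavy ?F)"
    by (intro psubset_card_mono finite_heavy min_fas_finite[OF R F'])
  then show False using F F' by (force simp: best_fas_def)
qed

lemma through_pred:
  assumes "orgraph4 R" "best_fas R F"
    and "card (F\<inverse> `` {v}) = 1" "card (F `` {v}) = 1" "(u, v) \<in> F"
  shows "card (F `` {u}) = 2"
  using through_succ[OF orgraph4_converse[OF assms(1)] best_fas_converse[OF assms(2)], of v u]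
    assms(3-5) by simp

lemma best_fas_exists:
  assumes "finite R"
  shows "\<exists>F. best_fas R F"
proof -
  have "fas R R" by (simp add: fas_def acyclic_def)
  then obtain F where F: "min_fas R F"
    using ex_has_least_nat[of "fas R" R card] by (auto simp: min_fas_def)
  have "card (heavy F') < Suc (card (Field R))" if "min_fas R F'" for F'
  proof -
    have FR: "F' \<subseteq> R" using that by (intro fas_subset min_fas_fas)
    have "heavy F' \<subseteq> Field R"
    proof
      fix v assume "v \<in> heavy F'"
      then have "F'\<inverse> `` {v} \<noteq> {} \<or> F' `` {v} \<noteq> {}" by (auto simp: heavy_def)
      then show "v \<in> Field R" using FR by (auto simp: Field_def)
    qed
    then show ?thesis using assms by (simp add: card_mono finite_Field less_Suc_eq_le)
  qed
  then show ?thesis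
    using ex_has_greatest_nat[of "min_fas R" F "\<lambda>F. card (heavy F)" "Suc (card (Field R))"] F
    by (auto simp: best_fas_def)
qed

section \<open>Components of \<open>F\<close> and their total deficiency\<close>

lemma deg_insert:
  assumes "finite F" "(a, b) \<notin> F" "a \<noteq> b"
  shows "deg (insert (a, b) F) x = deg F x + (if x = a \<or> x = b then 1 else 0)"
proof -
  have "(insert (a, b) F)\<inverse> `` {x} = (if x = b then insert a (F\<inverse> `` {x}) else F\<inverse> `` {x})"
    "insert (a, b) F `` {x} = (if x = a then insert b (F `` {x}) else F `` {x})"
    by auto
  then show ?thesis using assms by (auto simp: deg_def finite_Image)
qed

text \<open>
  The classes of \<open>k\<close> are the components of \<open>F\<close>. Adding an arc lowers the total deficiency
  \<open>2 - deg\<close> by \<open>2\<close> and merges at most two classes, so every class keeps deficiency at most \<open>2\<close>.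
\<close>
lemma component_map:
  assumes "finite V" "finite F" "F \<subseteq> V \<times> V" "\<And>v. (v, v) \<notin> F"
  shows "\<exists>k :: 'a \<Rightarrow> nat. (\<forall>(u, v) \<in> F. k u = k v) \<and>
    (\<forall>c. (\<Sum>v | v \<in> V \<and> k v = c. 2 - int (deg F v)) \<le> 2) \<and>
    (\<forall>S. (\<forall>(u, v) \<in> F. u \<in> S \<longleftrightarrow> v \<in> S) \<longrightarrow>
      (\<forall>u \<in> V. \<forall>v \<in> V. k u = k v \<longrightarrow> u \<in> S \<longrightarrow> v \<in> S))"
  using assms(2,3,4)
proof (induction F rule: finite_induct)
  case empty
  \<comment> \<open>An injective \<open>k\<close> makes every class a single vertex, of deficiency
    exactly 2.\<close>
  obtain k :: "'a \<Rightarrow> nat" where k: "inj_on k V"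
    using finite_imp_inj_to_nat_seg[OF assms(1)] by metis
  have "(\<Sum>v | v \<in> V \<and> k v = c. 2 - int (deg {} v)) \<le> 2" for c
  proof (cases "\<exists>v \<in> V. k v = c")
    case True
    then obtain v where "v \<in> V" "k v = c" by blast
    then have "{v. v \<in> V \<and> k v = c} = {v}" using k by (auto simp: inj_on_def)
    then show ?thesis by (simp add: deg_def)
  next
    case False
    then have E: "{v. v \<in> V \<and> k v = c} = {}" by auto
    show ?thesis unfolding E by simp
  qed
  moreover have "k u = k v \<Longrightarrow> u = v" if "u \<in> V" "v \<in> V" for u v
    using k that by (simp add: inj_on_def)
  ultimately show ?case by (intro exI[of _ k] conjI allI impI ballI) (simp, simp, metis)
next
  case (insert e F)
  obtain a b where e: "e = (a, b)" by force
  have ab: "a \<in> V" "b \<in> V" "a \<noteq> b" using insert.prems e by auto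
  have d: "deg (insert e F) x = deg F x + (if x = a \<or> x = b then 1 else 0)" for x
    using deg_insert[of F a b x] insert.hyps e ab by simp
  obtain k :: "'a \<Rightarrow> nat" where kF: "\<forall>(u, v) \<in> F. k u = k v"
    and ks: "\<forall>c. (\<Sum>v | v \<in> V \<and> k v = c. 2 - int (deg F v)) \<le> 2"
    and kS: "\<forall>S. (\<forall>(u, v) \<in> F. u \<in> S \<longleftrightarrow> v \<in> S) \<longrightarrow>
      (\<forall>u \<in> V. \<forall>v \<in> V. k u = k v \<longrightarrow> u \<in> S \<longrightarrow> v \<in> S)"
  proof -
    have "F \<subseteq> V \<times> V" "\<And>v. (v, v) \<notin> F" using insert.prems by auto
    from insert.IH[OF this] show ?thesis by (elim exE conjE) (rule that)
  qed
  \<comment> \<open>The class of \<open>b\<close> is merged into that of \<open>a\<close>.\<close>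
  define k' where "k' x = (if k x = k b then k a else k x)" for x
  let ?s = "\<lambda>A. \<Sum>v \<in> A. 2 - int (deg F v)" and ?s' = "\<lambda>A. \<Sum>v \<in> A. 2 - int (deg (insert e F) v)"
  have s': "?s' A = ?s A - int (card (A \<inter> {a, b}))" if "finite A" for A
  proof -
    have "?s' A = (\<Sum>v \<in> A. (2 - int (deg F v)) - (if v \<in> {a, b} then 1 else 0))"
      by (rule sum.cong) (auto simp: d)
    also have "\<dots> = ?s A - (\<Sum>v \<in> A. if v \<in> {a, b} then 1 else 0)"
      by (rule sum_subtractf)
    also have "(\<Sum>v \<in> A. if v \<in> {a, b} then 1 else 0) = int (card (A \<inter> {a, b}))"
      using that by (subst sum.inter_restrict[symmetric]) auto
    finally show ?thesis .
  qed
  have fin: "finite {v. v \<in> V \<and> P v}" for P using assms(1) by simp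
  have sum': "?s' {v. v \<in> V \<and> k' v = c} \<le> 2" for c
  proof (cases "c = k a")
    case False
    then have "{v. v \<in> V \<and> k' v = c} = {} \<or> {v. v \<in> V \<and> k' v = c} = {v. v \<in> V \<and> k v = c}"
      by (auto simp: k'_def)
    then show ?thesis
    proof
      assume E: "{v. v \<in> V \<and> k' v = c} = {}"
      show ?thesis unfolding E by simp
    next
      assume E: "{v. v \<in> V \<and> k' v = c} = {v. v \<in> V \<and> k v = c}"
      show ?thesis unfolding E s'[OF fin] using ks[rule_format, of c] by linarith
    qed
  next
    case True
    let ?A = "{v. v \<in> V \<and> k v = k a}" and ?B = "{v. v \<in> V \<and> k v = k b}"
    have U: "{v. v \<in> V \<and> k' v = c} = ?A \<union> ?B" using True by (auto simp: k'_def)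
    have "(?A \<union> ?B) \<inter> {a, b} = {a, b}" using ab by auto
    then have "?s' (?A \<union> ?B) = ?s (?A \<union> ?B) - 2"
      using s'[of "?A \<union> ?B"] fin ab by simp
    \<comment> \<open>Two distinct classes contribute at most 2 each; if \<open>a\<close> and
      \<open>b\<close> already share a class, the union is that single class.\<close>
    moreover have "?s (?A \<union> ?B) \<le> 4"
    proof (cases "k a = k b")
      case True
      then show ?thesis using ks[rule_format, of "k a"] by simp
    next
      case False
      then have "?s (?A \<union> ?B) = ?s ?A + ?s ?B"
        using fin by (intro sum.union_disjoint) auto
      then show ?thesis using ks[rule_format, of "k a"] ks[rule_format, of "k b"] by simp
    qed
    ultimately show ?thesis by (simp add: U)
  qed
  have arcs': "\<forall>(u, v) \<in> insert e F. k' u = k' v"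
    using kF by (auto simp: e k'_def)
  have closed': "v \<in> S"
    if S: "\<forall>(u, v) \<in> insert e F. u \<in> S \<longleftrightarrow> v \<in> S" and uv: "u \<in> V" "v \<in> V" "k' u = k' v" "u \<in> S" for S u v
  proof -
    have *: "x \<in> S \<Longrightarrow> y \<in> S" if "x \<in> V" "y \<in> V" "k x = k y" for x y
    proof -
      have "\<forall>(u, v) \<in> F. u \<in> S \<longleftrightarrow> v \<in> S" using S by simp
      from kS[THEN spec, THEN mp, OF this] that show "x \<in> S \<Longrightarrow> y \<in> S" by blast
    qed
    have "a \<in> S \<longleftrightarrow> b \<in> S" using S by (simp add: e)
    moreover have "k u = k v \<or> k u = k a \<and> k b = k v \<or> k u = k b \<and> k a = k v"
      using uv(3) by (auto simp: k'_def split: if_splits)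
    ultimately show ?thesis
      using *[of u v] *[of u a] *[of u b] *[of a v] *[of b v] uv(1,2,4) ab(1,2) by metis
  qed
  show ?case
    by (rule exI[of _ k'], intro conjI allI impI ballI) (use arcs' in blast, fact sum', erule (4) closed')
qed

section \<open>The two rankings of the vertices\<close>

text \<open>
  The sets \<open>A\<close> and \<open>B\<close> hold the first and second ends of the components of \<open>F\<close>; all other vertices
  have \<open>F\<close>-degree \<open>2\<close> and get ranks \<open>3\<close> to \<open>5\<close>.
\<close>
definition rank :: "'a rel \<Rightarrow> 'a set \<Rightarrow> 'a set \<Rightarrow> 'a \<Rightarrow> int" where
  "rank F A B v =
    (if v \<in> A then 1 else if F `` {v} \<inter> A \<noteq> {} then 0
     else if v \<in> B then 8 else if F\<inverse> `` {v} \<inter> B \<noteq> {} then 9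
     else 3 + int (card (F\<inverse> `` {v})))"

text \<open>Collects what the extremal choice and the component map provide. By
  \<open>class_closed\<close>, a class lies inside every \<open>F\<close>-closed set that meets it.
  The assumptions are symmetric in \<open>A\<close> and \<open>B\<close>.\<close>

locale labelled_fas =
  fixes R F :: "'a rel" and k :: "'a \<Rightarrow> nat" and A B :: "'a set"
  assumes finF: "finite F" and FR: "F \<subseteq> R"
    and asym: "(u, v) \<in> R \<Longrightarrow> (v, u) \<notin> R"
    and deg2: "deg F v \<le> 2"
    and thru_succ: "card (F\<inverse> `` {v}) = 1 \<Longrightarrow> card (F `` {v}) = 1 \<Longrightarrow> (v, w) \<in> F \<Longrightarrow> card (F\<inverse> `` {w}) = 2"
    and thru_pred: "card (F\<inverse> `` {v}) = 1 \<Longrightarrow> card (F `` {v}) = 1 \<Longrightarrow> (u, v) \<in> F \<Longrightarrow> card (F `` {u}) = 2"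
    and light: "(u, v) \<in> R \<Longrightarrow> (u, v) \<notin> F \<Longrightarrow> deg F u \<le> 1 \<or> deg F v \<le> 1"
    and class_F: "(u, v) \<in> F \<Longrightarrow> k u = k v"
    and class_closed: "(\<And>x y. (x, y) \<in> F \<Longrightarrow> x \<in> S \<longleftrightarrow> y \<in> S) \<Longrightarrow>
      u \<in> Field R \<Longrightarrow> v \<in> Field R \<Longrightarrow> k u = k v \<Longrightarrow> u \<in> S \<Longrightarrow> v \<in> S"
    and ends: "v \<in> Field R \<Longrightarrow> deg F v \<le> 1 \<Longrightarrow> v \<in> A \<union> B"
    and ends_deg: "v \<in> A \<union> B \<Longrightarrow> deg F v \<le> 1"
    and AB: "A \<inter> B = {}"
    and A_unique: "u \<in> A \<Longrightarrow> v \<in> A \<Longrightarrow> k u = k v \<Longrightarrow> u = v"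
    and B_unique: "u \<in> B \<Longrightarrow> v \<in> B \<Longrightarrow> k u = k v \<Longrightarrow> u = v"
begin

text \<open>Transfers each fact about \<open>rank F A B\<close> to the second ranking
  \<open>rank F B A\<close>.\<close>

lemma swap: "labelled_fas R F k B A"
proof (unfold_locales, goal_cases)
  case (9 S u v)
  then show ?case using class_closed by blast
qed (use finF FR asym deg2 thru_succ thru_pred light class_F ends ends_deg AB A_unique B_unique in blast)+

lemma in_pos: "(u, v) \<in> F \<Longrightarrow> 1 \<le> card (F\<inverse> `` {v})"
  using finF by (auto simp: Suc_le_eq card_gt_0_iff)

lemma out_pos: "(u, v) \<in> F \<Longrightarrow> 1 \<le> card (F `` {u})"
  using finF by (auto simp: Suc_le_eq card_gt_0_iff)

lemma through:
  assumes "(u, v) \<in> F" "(v, w) \<in> F"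
  shows "card (F\<inverse> `` {v}) = 1" "card (F `` {v}) = 1"
  using in_pos[OF assms(1)] out_pos[OF assms(2)] deg2[of v] by (auto simp: deg_def)

text \<open>The middle vertex has one arc of \<open>F\<close> in and one out, so \<open>w\<close>
  has two incoming arcs of \<open>F\<close>, too many for an end.\<close>

lemma no_two_steps_to_end:
  assumes "(u, v) \<in> F" "(v, w) \<in> F" shows "w \<notin> A \<union> B"
  using thru_succ[OF through[OF assms] assms(2)] ends_deg[of w] by (auto simp: deg_def)

lemma no_two_steps_from_end:
  assumes "(u, v) \<in> F" "(v, w) \<in> F" shows "u \<notin> A \<union> B"
  using thru_pred[OF through[OF assms] assms(1)] ends_deg[of u] by (auto simp: deg_def)

lemma rank_bounds: "0 \<le> rank F A B v" "rank F A B v \<le> 9"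
  using deg2[of v] by (auto simp: rank_def deg_def)

lemma rank_less_F:
  assumes uv: "(u, v) \<in> F"
  shows "rank F A B u < rank F A B v"
proof -
  have ne: "u \<noteq> v" using uv FR asym by blast
  have Auv: "\<not> (u \<in> A \<and> v \<in> A)" and Buv: "\<not> (u \<in> B \<and> v \<in> B)"
    using A_unique[of u v] B_unique[of u v] class_F[OF uv] ne by blast+
  \<comment> \<open>These two facts exclude rank 0 for \<open>v\<close> and rank 9 for
    \<open>u\<close>.\<close>
  have vA: "F `` {v} \<inter> A = {}" using no_two_steps_to_end[OF uv] by blast
  have uB: "F\<inverse> `` {u} \<inter> B = {}" using no_two_steps_from_end[OF _ uv] by blast
  show ?thesis
  proof (cases "v \<in> A \<or> u \<in> A \<or> F `` {u} \<inter> A \<noteq> {}")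
    case True
    then show ?thesis using Auv vA uv by (auto simp: rank_def)
  next
    case False
    then have vr: "rank F A B v = (if v \<in> B then 8 else if F\<inverse> `` {v} \<inter> B \<noteq> {} then 9
     else 3 + int (card (F\<inverse> `` {v})))"
      and ur: "rank F A B u = (if u \<in> B then 8 else 3 + int (card (F\<inverse> `` {u})))"
      using vA uB by (auto simp: rank_def)
    show ?thesis
    proof (cases "u \<in> B")
      case True
      then have "v \<notin> B" "F\<inverse> `` {v} \<inter> B \<noteq> {}" using Buv uv by auto
      then show ?thesis using True by (simp add: vr ur)
    next
      case uB: False
      have "u \<in> Field R" using uv FR by (auto simp: Field_def)
      then have du: "deg F u = 2" using ends[of u] False uB deg2[of u] by fastforce
      have o: "1 \<le> card (F `` {u})" "1 \<le> card (F\<inverse> `` {v})"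
        using out_pos[OF uv] in_pos[OF uv] by auto
      then have i: "card (F\<inverse> `` {u}) \<le> 1" using du by (simp add: deg_def)
      \<comment> \<open>If \<open>u\<close> has one incoming arc of \<open>F\<close>, it also has
        one outgoing, so \<open>v\<close> has two incoming ones.\<close>
      have "card (F\<inverse> `` {u}) < card (F\<inverse> `` {v})"
      proof (cases "card (F\<inverse> `` {u}) = 1")
        case True
        then have "card (F `` {u}) = 1" using du by (simp add: deg_def)
        then show ?thesis using thru_succ[OF True _ uv] True by simp
      qed (use i o in linarith)
      then show ?thesis using i uB by (simp add: vr ur)
    qed
  qed
qed

text \<open>If \<open>u\<close> is the \<open>A\<close>-end, it has rank 1 in the first ranking and
  \<open>v\<close> has rank at least 3. If \<open>v\<close> is the \<open>A\<close>-end, it has rank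
  8 in the second ranking and \<open>u\<close> lies below it.\<close>

lemma rank_less_A:
  assumes uv: "(u, v) \<in> R" "(u, v) \<notin> F" and k: "k u = k v" and A: "u \<in> A \<or> v \<in> A"
  shows "rank F A B u < rank F A B v \<or> rank F B A u < rank F B A v"
proof -
  have ne: "u \<noteq> v" and vu: "(v, u) \<notin> F" using uv FR asym by blast+
  have fld: "u \<in> Field R" "v \<in> Field R" using uv by (auto simp: Field_def)
  show ?thesis
  proof (cases "u \<in> A")
    case True
    then have vA: "v \<notin> A" using A_unique[of u v] k ne by blast
    have "F `` {v} \<inter> A = {}"
    proof -
      have "a = u" if "(v, a) \<in> F" "a \<in> A" for a
        using A_unique[of a u] class_F[OF that(1)] k True that(2) by simp
      then show ?thesis using vu by blast
    qed
    then show ?thesis using True vA by (simp add: rank_def)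
  next
    case uA: False
    then have vA: "v \<in> A" using A by blast
    have vB: "v \<notin> B" using AB vA by blast
    have "F `` {v} \<inter> B = {}"
    proof (rule ccontr)
      \<comment> \<open>An arc of \<open>F\<close> from the \<open>A\<close>-end to the
        \<open>B\<close>-end is a whole component. Then \<open>u\<close> would be \<open>b\<close>,
        making \<open>(u, v)\<close> opposite to an arc of \<open>F\<close>.\<close>
      assume "F `` {v} \<inter> B \<noteq> {}"
      then obtain b where b: "(v, b) \<in> F" "b \<in> B" by blast
      have dv: "deg F v \<le> 1" "deg F b \<le> 1" using ends_deg vA b(2) by blast+
      have "card (F\<inverse> `` {v}) = 0" and v1: "card (F `` {v}) = 1"
        using dv(1) out_pos[OF b(1)] by (simp_all add: deg_def)
      then have 1: "F\<inverse> `` {v} = {}" by (simp only: card_eq_0_iff) (simp add: finF)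
      have "card (F `` {b}) = 0" and b1: "card (F\<inverse> `` {b}) = 1"
        using dv(2) in_pos[OF b(1)] by (simp_all add: deg_def)
      then have 2: "F `` {b} = {}" by (simp only: card_eq_0_iff) (simp add: finF)
      have 3: "F `` {v} = {b}" "F\<inverse> `` {b} = {v}"
        using v1 b1 b(1) by (metis Image_singleton_iff card_1_singletonE converse_iff singletonD)+
      have "x \<in> {v, b} \<longleftrightarrow> y \<in> {v, b}" if "(x, y) \<in> F" for x y
        using that 1 2 3 by blast
      then have "u \<in> {v, b}" using class_closed[of "{v, b}" v u] fld k by simp
      then show False using ne b(1) FR uv asym by blast
    qed
    then have "rank F B A v = 8" using vA vB by (simp add: rank_def)
    moreover have "F\<inverse> `` {u} \<inter> A = {}"
    proof -
      have "a = v" if "(a, u) \<in> F" "a \<in> A" for a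
        using A_unique[of a v] class_F[OF that(1)] k vA that(2) by simp
      then show ?thesis using vu by blast
    qed
    then have "rank F B A u < 8" using uA deg2[of u] by (auto simp: rank_def deg_def)
    ultimately show ?thesis by simp
  qed
qed

text \<open>By \<open>light\<close>, one endpoint has \<open>F\<close>-degree at most 1 and is thus
  an end; \<open>swap\<close> handles ends in \<open>B\<close>.\<close>

lemma rank_less_R:
  assumes uv: "(u, v) \<in> R" "(u, v) \<notin> F" and k: "k u = k v"
  shows "rank F A B u < rank F A B v \<or> rank F B A u < rank F B A v"
proof -
  have "u \<in> Field R" "v \<in> Field R" using uv by (auto simp: Field_def)
  then consider "u \<in> A \<or> v \<in> A" | "u \<in> B \<or> v \<in> B"
    using light[OF uv] ends by blast
  then show ?thesis
  proof cases
    case 1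
    then show ?thesis by (rule rank_less_A[OF uv k])
  next
    case 2
    then show ?thesis using labelled_fas.rank_less_A[OF swap uv k] by blast
  qed
qed

lemma two_rankings:
  "\<exists>(f :: 'a \<Rightarrow> int) (g :: 'a \<Rightarrow> int). (\<forall>(u, v) \<in> F. f u < f v \<and> g u < g v) \<and> (\<forall>(u, v) \<in> R. f u < f v \<or> g u < g v)"
proof -
  \<comment> \<open>Ranks lie between 0 and 9, so the weight 10 lets the class decide between
    different classes.\<close>
  define f where "f v = 10 * int (k v) + rank F A B v" for v
  define g where "g v = - 10 * int (k v) + rank F B A v" for v
  note bounds = rank_bounds labelled_fas.rank_bounds[OF swap]
  have F: "f u < f v \<and> g u < g v" if "(u, v) \<in> F" for u v
    using rank_less_F[OF that] labelled_fas.rank_less_F[OF swap that] class_F[OF that]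
    by (simp add: f_def g_def)
  have "f u < f v \<or> g u < g v" if uv: "(u, v) \<in> R" for u v
  proof (cases "(u, v) \<in> F")
    case True
    then show ?thesis using F by blast
  next
    case False
    consider "k u = k v" | "k u < k v" | "k v < k u" by linarith
    then show ?thesis
    proof cases
      case 1
      then show ?thesis using rank_less_R[OF uv False] by (simp add: f_def g_def)
    next
      case 2
      then show ?thesis using bounds(1,2)[of u] bounds(1,2)[of v] by (simp add: f_def)
    next
      case 3
      then show ?thesis using bounds(3,4)[of u] bounds(3,4)[of v] by (simp add: g_def)
    qed
  qed
  then have "(\<forall>(u, v) \<in> F. f u < f v \<and> g u < g v) \<and> (\<forall>(u, v) \<in> R. f u < f v \<or> g u < g v)"
    using F by blast
  then show ?thesis by (intro exI)
qed

end

section \<open>Labelling the ends and splitting the arcs\<close>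

text \<open>A vertex of degree at most 1 has deficiency at least 1, so each class has at most two of
  them: \<open>A\<close> takes a chosen one, \<open>B\<close> the other if there is one.\<close>

lemma ends_labelling:
  fixes k :: "'a \<Rightarrow> nat"
  assumes "finite V" and deg: "\<And>v. deg F v \<le> 2"
    and sum: "\<And>c. (\<Sum>v | v \<in> V \<and> k v = c. 2 - int (deg F v)) \<le> 2"
  shows "\<exists>A B. A \<union> B = {v \<in> V. deg F v \<le> 1} \<and> A \<inter> B = {} \<and> inj_on k A \<and> inj_on k B"
proof -
  let ?E = "{v \<in> V. deg F v \<le> 1}"
  have two: "card {v \<in> ?E. k v = c} \<le> 2" for c
  proof -
    have "int (card {v \<in> ?E. k v = c}) = (\<Sum>v \<in> {v \<in> ?E. k v = c}. 1)" by simp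
    also have "\<dots> \<le> (\<Sum>v \<in> {v \<in> ?E. k v = c}. 2 - int (deg F v))"
      by (rule sum_mono) auto
    also have "\<dots> \<le> (\<Sum>v | v \<in> V \<and> k v = c. 2 - int (deg F v))"
      by (rule sum_mono2) (use assms(1) deg in \<open>auto simp: of_nat_le_iff[of _ 2, simplified]\<close>)
    finally show ?thesis using sum[of c] by linarith
  qed
  define a where "a c = (SOME v. v \<in> ?E \<and> k v = c)" for c
  define A where "A = {v \<in> ?E. v = a (k v)}"
  have aE: "a (k v) \<in> ?E \<and> k (a (k v)) = k v" if "v \<in> ?E" for v
    unfolding a_def by (rule someI[of _ v]) (use that in simp)
  have "inj_on k A" by (auto simp: inj_on_def A_def)
  moreover have "inj_on k (?E - A)"
  proof (rule inj_onI, rule ccontr)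
    fix u v assume uv: "u \<in> ?E - A" "v \<in> ?E - A" "k u = k v" "u \<noteq> v"
    let ?w = "a (k u)"
    have w: "?w \<in> ?E" "k ?w = k u" "?w \<noteq> u" "?w \<noteq> v"
      using aE[of u] uv by (auto simp: A_def)
    have "card {u, v, ?w} \<le> card {x \<in> ?E. k x = k u}"
      by (rule card_mono) (use assms(1) uv w in auto)
    then show False using two[of "k u"] uv(4) w(3,4) by auto
  qed
  ultimately show ?thesis by (intro exI[of _ A] exI[of _ "?E - A"]) (auto simp: A_def)
qed

lemma orgraph4_fas_partition:
  assumes R: "orgraph4 R"
  shows "\<exists>F1 F2 F3. F1 \<union> F2 \<union> F3 = R \<and> F1 \<inter> F2 = {} \<and> F1 \<inter> F3 = {} \<and> F2 \<inter> F3 = {} \<and>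
    fas R F1 \<and> fas R F2 \<and> fas R F3"
proof -
  obtain F where F: "best_fas R F" using best_fas_exists R unfolding orgraph4_def by blast
  have mF: "min_fas R F" using F by (rule best_fas_min_fas)
  have FR: "F \<subseteq> R" using mF by (intro fas_subset min_fas_fas)
  have finF: "finite F" using R mF by (rule min_fas_finite)
  have fV: "finite (Field R)" using R by (simp add: orgraph4_def finite_Field)
  have FV: "F \<subseteq> Field R \<times> Field R" using FR by (auto simp: Field_def)
  have irr: "(v, v) \<notin> F" for v using FR orgraph4_irrefl[OF R] by blast
  obtain k :: "'a \<Rightarrow> nat" where kF: "\<forall>(u, v) \<in> F. k u = k v"
    and ks: "\<forall>c. (\<Sum>v | v \<in> Field R \<and> k v = c. 2 - int (deg F v)) \<le> 2"
    and kS: "\<forall>S. (\<forall>(u, v) \<in> F. u \<in> S \<longleftrightarrow> v \<in> S) \<longrightarrow>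
      (\<forall>u \<in> Field R. \<forall>v \<in> Field R. k u = k v \<longrightarrow> u \<in> S \<longrightarrow> v \<in> S)"
    using component_map[OF fV finF FV irr] by (elim exE conjE) (rule that)
  obtain A B where AB: "A \<union> B = {v \<in> Field R. deg F v \<le> 1}" "A \<inter> B = {}" "inj_on k A" "inj_on k B"
    using ends_labelling[OF fV deg_min_fas_le_2[OF R mF] ks[rule_format]] by metis
  interpret labelled_fas R F k A B
  proof (unfold_locales, goal_cases)
    case (3 u v) then show ?case using R by (simp add: orgraph4_def)
  next
    case (5 v w) then show ?case by (rule through_succ[OF R F])
  next
    case (6 v u) then show ?case by (rule through_pred[OF R F])
  next
    case (7 u v) then show ?case
      using deg_out_neighbour_le_1[OF R mF _ 7] deg_min_fas_le_2[OF R mF, of u] by linarith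
  next
    case (9 S u v)
    then have "\<forall>(u, v) \<in> F. u \<in> S \<longleftrightarrow> v \<in> S" by blast
    from kS[THEN spec, THEN mp, OF this] 9(2-5) show ?case by blast
  next
    case (10 v) then show ?case using AB(1) by blast
  qed (use finF FR deg_min_fas_le_2[OF R mF] kF AB in \<open>auto simp: inj_on_def\<close>)
  obtain f g :: "'a \<Rightarrow> int" where fgF: "\<And>u v. (u, v) \<in> F \<Longrightarrow> f u < f v \<and> g u < g v"
    and fg: "\<And>u v. (u, v) \<in> R \<Longrightarrow> f u < f v \<or> g u < g v"
    using two_rankings by blast
  define F1 where "F1 = {(u, v) \<in> R - F. f u < f v}"
  define F2 where "F2 = {(u, v) \<in> R - F. \<not> f u < f v}"
  \<comment> \<open>Arcs outside \<open>F1\<close> all increase \<open>g\<close>, and arcs outside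
    \<open>F2\<close> all increase \<open>f\<close>; the signs are negated because
    \<open>acyclicI_order\<close> wants a decreasing function.\<close>
  have "acyclic (R - F1)"
    by (rule acyclicI_order[of _ "\<lambda>v. - g v"]) (use fg fgF in \<open>fastforce simp: F1_def\<close>)
  moreover have "acyclic (R - F2)"
    by (rule acyclicI_order[of _ "\<lambda>v. - f v"]) (use fgF in \<open>auto simp: F2_def\<close>)
  ultimately have "fas R F1" "fas R F2" by (auto simp: fas_def F1_def F2_def)
  moreover have "F1 \<union> F2 \<union> F = R" "F1 \<inter> F2 = {}" "F1 \<inter> F = {}" "F2 \<inter> F = {}"
    using FR by (auto simp: F1_def F2_def)
  ultimately show ?thesis using min_fas_fas[OF mF] by blast
qed

section \<open>Transfer between digraphs and arc relations\<close>

lemma (in oriented_graph) orgraph4_arcs_ends: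
  assumes "max_degree G \<le> 4"
  shows "orgraph4 (arcs_ends G)"
  unfolding orgraph4_def
proof (intro conjI allI impI notI)
  show "finite (arcs_ends G)" by (simp add: arcs_ends_def)
next
  fix u v assume "(u, v) \<in> arcs_ends G" "(v, u) \<in> arcs_ends G"
  then obtain a b where "a \<in> arcs G" "tail G a = u" "head G a = v"
    "b \<in> arcs G" "tail G b = v" "head G b = u" by (auto simp: arcs_ends_conv)
  then have "cycle [a, b]"
    using no_loops[of a] by (auto simp: cycle_def awalk_simps intro!: exI[of _ u])
  then show False using no_2cycles by fastforce
next
  fix v
  have "(arcs_ends G)\<inverse> `` {v} = tail G ` in_arcs G v" "arcs_ends G `` {v} = head G ` out_arcs G v"
    by (auto simp: arcs_ends_conv)
  then have "deg (arcs_ends G) v \<le> in_degree G v + out_degree G v"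
    by (simp add: deg_def in_degree_def out_degree_def add_mono card_image_le
      finite_in_arcs finite_out_arcs)
  \<comment> \<open>The bound is needed for every \<open>v\<close> of the type; outside
    \<open>verts G\<close> no arcs are incident.\<close>
  also have "\<dots> \<le> 4"
  proof (cases "v \<in> verts G")
    case True
    then show ?thesis using assms by (simp add: max_degree_le_iff)
  next
    case False
    then have "in_arcs G v = {}" "out_arcs G v = {}" by auto
    then show ?thesis by (simp add: in_degree_def out_degree_def)
  qed
  finally show "deg (arcs_ends G) v \<le> 4" .
qed

text \<open>A cycle left after the deletion is a nonempty closed walk, hence a closed chain of pairs
  in \<open>arcs_ends G - F\<close>.\<close>

lemma (in wf_digraph) feedback_arc_set_of_fas:
  assumes "fas (arcs_ends G) F"
  shows "feedback_arc_set G {e \<in> arcs G. arc_to_ends G e \<in> F}"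
  unfolding feedback_arc_set_def
proof (intro conjI notI)
  let ?H = "del_arcs G {e \<in> arcs G. arc_to_ends G e \<in> F}"
  interpret H: wf_digraph ?H by unfold_locales (auto simp: del_arcs_def)
  assume "\<exists>p. H.cycle p"
  then obtain u p where "H.awalk u p u" "p \<noteq> []" by (auto simp: H.cycle_def)
  then have "(u, u) \<in> (arcs_ends ?H)\<^sup>+" using H.reachable1_awalk by blast
  moreover have "arcs_ends ?H \<subseteq> arcs_ends G - F"
    by (auto simp: arcs_ends_def arc_to_ends_def del_arcs_def)
  ultimately have "(u, u) \<in> (arcs_ends G - F)\<^sup>+" using trancl_mono by blast
  then show False using assms by (auto simp: fas_def acyclic_def)
qed auto

theorem theorem1:
  fixes H :: "('a, 'b) pre_digraph"
  assumes "oriented_graph H"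
    and "max_degree H \<le> 4"
    and "directed_girth H \<ge> 3"
  shows "\<exists>F1 F2 F3. F1 \<union> F2 \<union> F3 = arcs H
    \<and> F1 \<inter> F2 = {} \<and> F1 \<inter> F3 = {} \<and> F2 \<inter> F3 = {}
    \<and> feedback_arc_set H F1 \<and> feedback_arc_set H F2 \<and> feedback_arc_set H F3"
proof -
  interpret oriented_graph H by fact
  obtain F1 F2 F3 where F: "F1 \<union> F2 \<union> F3 = arcs_ends H"
      "F1 \<inter> F2 = {}" "F1 \<inter> F3 = {}" "F2 \<inter> F3 = {}"
    and fas: "fas (arcs_ends H) F1" "fas (arcs_ends H) F2" "fas (arcs_ends H) F3"
    using orgraph4_fas_partition[OF orgraph4_arcs_ends[OF assms(2)]] by metis
  \<comment> \<open>Preimages under \<open>arc_to_ends\<close> carry the partition of arc pairs back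
    to a partition of the arcs.\<close>
  let ?P = "\<lambda>F. {e \<in> arcs H. arc_to_ends H e \<in> F}"
  have "?P F1 \<union> ?P F2 \<union> ?P F3 = {e \<in> arcs H. arc_to_ends H e \<in> F1 \<union> F2 \<union> F3}" by blast
  also have "\<dots> = arcs H" unfolding F(1) by (auto simp: arcs_ends_def)
  finally have "?P F1 \<union> ?P F2 \<union> ?P F3 = arcs H" .
  moreover have "?P F1 \<inter> ?P F2 = {}" "?P F1 \<inter> ?P F3 = {}" "?P F2 \<inter> ?P F3 = {}"
    using F(2-4) by blast+
  ultimately show ?thesis using fas[THEN feedback_arc_set_of_fas] by blast
qed

end
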